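(* Let $f$ be a $\mu$-strongly convex function, let $r>0$ and $0\le\alpha\le1$, and let $x(t)$ be a solution of $$\ddot x+\frac{r}{t^\alpha}\dot x+\nabla f(x)=0$$ with initial conditions $x(t_0)=x_0$, $\dot x(t_0)=0$ (where $t_0>0$ if $\alpha>0$). Let $L(t)$ and $T(\mu,\alpha,r,\beta)$ be as defined in the context. (i) If $\alpha=0$, then $$f(x(t))-f^*\le\left[\frac\mu2\|x_0-x^*\|^2+f(x_0)-f^*\right]e^{-\sqrt\mu\,t}$$ when $t\ge t_0=0$ and $r=2\sqrt\mu$. (ii) If $0<\alpha<1$, then $$f(x(t))-f^*\le L(T)\,e^{-\frac{r}{2(1-\alpha)}t^{1-\alpha}}$$ when $t\ge T$, where $T=T(\mu,\alpha,r,\beta)$ and $L(t)$ are taken with $\beta=\frac12$. (iii) If $\alpha=1$, then $$f(x(t))-f^*\le L(T)\,t^{-\frac{1+r}{2}}$$ when $r>3$ and $t\ge T=\sqrt{\frac{(r-3)(r+1)}{4\mu}}$, where $L(t)$ is taken with $\beta=\frac{1+r}{2r}$; or $$f(x(t))-f^*\le\left[\frac r3\left(\frac r3+1\right)t_0^{\frac23r-2}\|x_0-x^*\|^2+t_0^{\frac23r}(f(x_0)-f^* )\right]t^{-\frac23r}$$ when $t\ge t_0$ and $r\le3$.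
   Context: Standing assumptions: $f:\mathbb{R}^d\to\mathbb{R}$ is twice continuously differentiable and convex, $\nabla f$ is Lipschitz continuous, $f$ has a unique minimizer $x^*$, and $f^*=f(x^* )$. The function $f$ is $\mu$-strongly convex if $f(y)-f(x)-\langle\nabla f(x),y-x\rangle\ge\frac\mu2\|y-x\|^2$ for all $x,y\in\mathbb{R}^d$. Dots denote derivatives with respect to $t$. Definitions. Let $\xi(t)=\frac{r}{1-\alpha}t^{1-\alpha}$ if $0\le\alpha<1$ and $\xi(t)=r\ln t$ if $\alpha=1$. For a parameter $\beta$ with $0\le\beta\le\frac12$ if $0\le\alpha<1$ and $0\le\beta\le\min\{\frac23,\frac{1+r}{2r}\}$ if $\alpha=1$, set $$D(t)=e^{\beta\xi(t)},\qquad B(t)=\sqrt{\beta r\left[(1-\beta)rt^{1-\alpha}+\alpha\right]t^{-\alpha-1}e^{\beta\xi(t)}},$$ $$A(t)=\sqrt{\frac{\beta rt^{1-\alpha}}{(1-\beta)rt^{1-\alpha}+\alpha}e^{\beta\xi(t)}},\qquad C(t)=\left[1-\frac{\beta rt^{1-\alpha}}{(1-\beta)rt^{1-\alpha}+\alpha}\right]e^{\beta\xi(t)},$$ and $$L(t)=\frac12\|A(t)\dot x(t)+B(t)(x(t)-x^* )\|^2+\frac12C(t)\|\dot x(t)\|^2+D(t)(f(x(t))-f^* ).$$ $T(\mu,\alpha,r,\beta)$ is either the largest root of $P(t;\mu,\alpha,r,\beta)=\mu t^2-(1-\beta)\beta r^2t^{2(1-\alpha)}+(2-3\beta)r\alpha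 t^{1-\alpha}+\alpha(\alpha+1)$, or zero if $P$ has no root. *)

theory Defs
  imports "HOL-Analysis.Analysis"
begin

definition twice_continuously_differentiable :: "('a::euclidean_space \<Rightarrow> real) \<Rightarrow> bool" where
  "twice_continuously_differentiable f \<longleftrightarrow>
     (\<exists>g (H :: 'a \<Rightarrow> 'a \<Rightarrow>\<^sub>L 'a).
        (\<forall>x. GDERIV f x :> g x) \<and>
        (\<forall>x. (g has_derivative blinfun_apply (H x)) (at x)) \<and>
        continuous_on UNIV H)"

(* The argument g is the gradient of f. *)
definition strongly_convex ::
    "real \<Rightarrow> ('a::euclidean_space \<Rightarrow> real) \<Rightarrow> ('a \<Rightarrow> 'a) \<Rightarrow> bool" where
  "strongly_convex \<mu> f g \<longleftrightarrow>
     (\<forall>x y. f y - f x - g x \<bullet> (y - x) \<ge> \<mu> / 2 * (norm (y - x))\<^sup>2)"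

definition unique_minimizer :: "('a \<Rightarrow> real) \<Rightarrow> 'a \<Rightarrow> bool" where
  "unique_minimizer f z \<longleftrightarrow> (\<forall>y. is_arg_min f (\<lambda>_. True) y \<longleftrightarrow> y = z)"

(* r / t^alpha; the case distinction is needed because 0 powr 0 = 0 in HOL,
   whereas the coefficient for alpha = 0 is the constant r, also at t = 0. *)
definition damping :: "real \<Rightarrow> real \<Rightarrow> real \<Rightarrow> real" where
  "damping \<alpha> r t = (if \<alpha> = 0 then r else r / t powr \<alpha>)"

(* x'' + (r / t^alpha) x' + g x = 0 on I, with v = x'.  Derivatives at an end point
   of I that belongs to I are one-sided. *)
definition ode_solution ::
    "real \<Rightarrow> real \<Rightarrow> ('a::euclidean_space \<Rightarrow> 'a) \<Rightarrow> real set \<Rightarrow> (real \<Rightarrow> 'a) \<Rightarrow> (real \<Rightarrow> 'a) \<Rightarrow> bool"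
  where
  "ode_solution \<alpha> r g I x v \<longleftrightarrow>
     (\<forall>t\<in>I. (x has_vector_derivative v t) (at t within I) \<and>
        (\<exists>a. (v has_vector_derivative a) (at t within I) \<and>
             a + damping \<alpha> r t *\<^sub>R v t + g (x t) = 0))"

definition xi :: "real \<Rightarrow> real \<Rightarrow> real \<Rightarrow> real" where
  "xi \<alpha> r t = (if \<alpha> = 1 then r * ln t else r / (1 - \<alpha>) * t powr (1 - \<alpha>))"

(* The coefficients of the Lyapunov function are meaningful for t > 0 only. *)

definition coeff_A :: "real \<Rightarrow> real \<Rightarrow> real \<Rightarrow> real \<Rightarrow> real" where
  "coeff_A \<alpha> r \<beta> t =
     sqrt (\<beta> * r * t powr (1 - \<alpha>) / ((1 - \<beta>) * r * t powr (1 - \<alpha>) + \<alpha>) * exp (\<beta> * xi \<alpha> r t))"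

definition coeff_B :: "real \<Rightarrow> real \<Rightarrow> real \<Rightarrow> real \<Rightarrow> real" where
  "coeff_B \<alpha> r \<beta> t =
     sqrt (\<beta> * r * ((1 - \<beta>) * r * t powr (1 - \<alpha>) + \<alpha>) * t powr (- \<alpha> - 1) * exp (\<beta> * xi \<alpha> r t))"

definition coeff_C :: "real \<Rightarrow> real \<Rightarrow> real \<Rightarrow> real \<Rightarrow> real" where
  "coeff_C \<alpha> r \<beta> t =
     (1 - \<beta> * r * t powr (1 - \<alpha>) / ((1 - \<beta>) * r * t powr (1 - \<alpha>) + \<alpha>)) * exp (\<beta> * xi \<alpha> r t)"

definition coeff_D :: "real \<Rightarrow> real \<Rightarrow> real \<Rightarrow> real \<Rightarrow> real" where
  "coeff_D \<alpha> r \<beta> t = exp (\<beta> * xi \<alpha> r t)"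

(* z is the minimizer of f and v is the derivative of the trajectory x. *)
definition lyapunov ::
    "real \<Rightarrow> real \<Rightarrow> real \<Rightarrow> ('a::euclidean_space \<Rightarrow> real) \<Rightarrow> 'a \<Rightarrow> (real \<Rightarrow> 'a) \<Rightarrow> (real \<Rightarrow> 'a) \<Rightarrow> real \<Rightarrow> real"
  where
  "lyapunov \<alpha> r \<beta> f z x v t =
     1 / 2 * (norm (coeff_A \<alpha> r \<beta> t *\<^sub>R v t + coeff_B \<alpha> r \<beta> t *\<^sub>R (x t - z)))\<^sup>2
     + 1 / 2 * coeff_C \<alpha> r \<beta> t * (norm (v t))\<^sup>2
     + coeff_D \<alpha> r \<beta> t * (f (x t) - f z)"

definition P_fun :: "real \<Rightarrow> real \<Rightarrow> real \<Rightarrow> real \<Rightarrow> real \<Rightarrow> real" where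
  "P_fun \<mu> \<alpha> r \<beta> t =
     \<mu> * t\<^sup>2 - (1 - \<beta>) * \<beta> * r\<^sup>2 * t powr (2 * (1 - \<alpha>))
     + (2 - 3 * \<beta>) * r * \<alpha> * t powr (1 - \<alpha>) + \<alpha> * (\<alpha> + 1)"

(* Only t > 0 is searched for roots: the real powers in P have no meaning for t < 0,
   and a root at t = 0 would give the default value 0 anyway. *)
definition T_val :: "real \<Rightarrow> real \<Rightarrow> real \<Rightarrow> real \<Rightarrow> real" where
  "T_val \<mu> \<alpha> r \<beta> =
     (if \<exists>t>0. P_fun \<mu> \<alpha> r \<beta> t = 0
      then (GREATEST t. t > 0 \<and> P_fun \<mu> \<alpha> r \<beta> t = 0) else 0)"

end

theory Submission
  imports Defs "HOL-Real_Asymp.Real_Asymp"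
begin

text \<open>
  Write \<open>y = x - x*\<close>, let \<open>p\<close> be the damping, so that \<open>x'' = - p x' - \<nabla>f(x)\<close>, and let
  \<open>e = exp (\<beta> \<xi>)\<close>, so that \<open>e' = \<beta> p e\<close>.  Multiplied out, the square roots in the
  Lyapunov function disappear and it becomes
  \<open>e (|x'|^2/2 + \<beta> p \<langle>x', y\<rangle> + (\<beta>(1-\<beta>) p^2 - \<beta> p') |y|^2/2 + f(x) - f*)\<close>.
  In its derivative the coefficient of \<open>|y|^2\<close> has been chosen so that the mixed terms
  \<open>\<langle>x', y\<rangle>\<close> cancel, and the two terms \<open>\<langle>\<nabla>f(x), x'\<rangle>\<close> cancel as well.  What
  remains is a multiple of \<open>|x'|^2\<close>, which is nonpositive for \<open>\<beta> \<le> 2/3\<close>, the term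
  \<open>\<beta> p (f(x) - f* - \<langle>\<nabla>f(x), y\<rangle>)\<close>, which strong convexity bounds by
  \<open>- \<beta> p \<mu> |y|^2/2\<close>, and a multiple of \<open>|y|^2\<close>.  For \<open>p = r t^{-\<alpha>}\<close> the last
  two together are at most \<open>- \<beta> p P(t) / t^2\<close> times \<open>|y|^2/2\<close>, so the Lyapunov function
  decreases wherever \<open>P \<ge> 0\<close>, in particular to the right of the largest root of \<open>P\<close>.
  The upper bounds on \<open>\<beta>\<close> depending on \<open>\<alpha>\<close> and \<open>r\<close> make the quadratic
  form in \<open>(x', y)\<close> positive semidefinite, so that \<open>e (f(x) - f*)\<close> lies below the Lyapunov
  function; this gives the rate \<open>1/e\<close>.

  The decay argument is carried out in \<open>damped_gradient_flow_decay\<close> for an arbitrary damping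
  \<open>p\<close>, which covers constant damping, where time may start at \<open>0\<close>, as well as
  \<open>r t^{-\<alpha>}\<close>.  The theorem \<open>lyapunov_bound\<close> specializes it to the latter by
  \<open>lyapunov_eq_twisted_energy\<close> and \<open>P_fun_nonneg_imp_rate_condition\<close>, and
  \<open>P_fun_nonneg_from_T_val\<close> supplies the sign of \<open>P\<close> for \<open>0 < \<alpha> < 1\<close>.
\<close>

section \<open>Energy decay under an arbitrary damping\<close>

text \<open>
  The arguments are values at one instant: the damping \<open>p\<close> and its derivative \<open>q\<close>, the
  displacement \<open>y\<close> from the minimizer, the velocity \<open>w\<close> and the gap \<open>h\<close> of the
  objective.  The coefficient of \<open>y \<bullet> y\<close> is the one for which no \<open>w \<bullet> y\<close> term
  survives in the derivative of the weighted energy along a trajectory.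
\<close>

definition twisted_energy :: "real \<Rightarrow> real \<Rightarrow> real \<Rightarrow> 'a::real_inner \<Rightarrow> 'a \<Rightarrow> real \<Rightarrow> real" where
  "twisted_energy \<beta> p q y w h =
     1 / 2 * (w \<bullet> w) + \<beta> * p * (w \<bullet> y) + 1 / 2 * (\<beta> * (1 - \<beta>) * p\<^sup>2 - \<beta> * q) * (y \<bullet> y) + h"

text \<open>
  Completing the square in \<open>w\<close> leaves a multiple of \<open>y \<bullet> y\<close> whose sign is decided by
  the hypothesis.
\<close>

lemma twisted_energy_ge:
  assumes "0 \<le> \<beta>" and "q \<le> (1 - 2 * \<beta>) * p\<^sup>2"
  shows "h \<le> twisted_energy \<beta> p q y w h"
proof -
  have "twisted_energy \<beta> p q y w h - h =
      1 / 2 * (norm (w + (\<beta> * p) *\<^sub>R y))\<^sup>2 + 1 / 2 * (\<beta> * ((1 - 2 * \<beta>) * p\<^sup>2 - q)) * (y \<bullet> y)"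
    unfolding twisted_energy_def power2_norm_eq_inner
    by (simp add: inner_add_left inner_add_right inner_commute algebra_simps power2_eq_square)
  moreover have "\<beta> * ((1 - 2 * \<beta>) * p\<^sup>2 - q) \<ge> 0"
    using assms by simp
  ultimately show ?thesis
    by (smt (verit) inner_ge_zero mult_nonneg_nonneg zero_le_power2 half_gt_zero)
qed

text \<open>
  The left-hand side is the derivative of the weighted energy divided by the weight: the first
  summand comes from the weight, and the bracket is the derivative of the energy with the
  acceleration replaced by \<open>- p w - G\<close>, where \<open>G\<close> is the gradient and \<open>s\<close> is the second
  derivative of the damping.  After the cancellations it is minus a sum of three nonnegative terms:
  a friction term, the slack in strong convexity, and the slack in \<open>cond\<close>.
\<close>

lemma twisted_energy_rate_nonpos:
  fixes y w G :: "'a::real_inner"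
  assumes beta: "0 \<le> \<beta>" "\<beta> \<le> 2 / 3" and p: "0 \<le> p"
    and h: "h + \<mu> / 2 * (y \<bullet> y) \<le> G \<bullet> y"
    and cond: "\<beta> * (1 - \<beta>) * p ^ 3 + (2 - 3 * \<beta>) * p * q - s \<le> \<mu> * p"
  shows "\<beta> * p * twisted_energy \<beta> p q y w h
     + (w \<bullet> (- (p *\<^sub>R w) - G) + \<beta> * q * (w \<bullet> y) + \<beta> * p * ((- (p *\<^sub>R w) - G) \<bullet> y + w \<bullet> w)
        + 1 / 2 * (2 * \<beta> * (1 - \<beta>) * p * q - \<beta> * s) * (y \<bullet> y)
        + (\<beta> * (1 - \<beta>) * p\<^sup>2 - \<beta> * q) * (w \<bullet> y) + G \<bullet> w) \<le> 0"
    (is "?lhs \<le> 0")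
proof -
  have "?lhs = - (p * (1 - 3 / 2 * \<beta>) * (w \<bullet> w))
      - \<beta> * p * (G \<bullet> y - h - \<mu> / 2 * (y \<bullet> y))
      - 1 / 2 * (\<beta> * (\<mu> * p - (\<beta> * (1 - \<beta>) * p ^ 3 + (2 - 3 * \<beta>) * p * q - s))) * (y \<bullet> y)"
    by (simp add: twisted_energy_def inner_diff_left inner_diff_right inner_commute
        algebra_simps power2_eq_square power3_eq_cube)
  moreover have "p * (1 - 3 / 2 * \<beta>) * (w \<bullet> w) \<ge> 0"
    using beta p by simp
  moreover have "\<beta> * p * (G \<bullet> y - h - \<mu> / 2 * (y \<bullet> y)) \<ge> 0"
    using beta p h by simp
  moreover have "1 / 2 * (\<beta> * (\<mu> * p - (\<beta> * (1 - \<beta>) * p ^ 3 + (2 - 3 * \<beta>) * p * q - s))) * (y \<bullet> y) \<ge> 0"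
    using beta cond by simp
  ultimately show ?thesis by argo
qed

theorem damped_gradient_flow_decay:
  fixes f :: "'a::euclidean_space \<Rightarrow> real" and x v :: "real \<Rightarrow> 'a"
  assumes grad: "\<And>y. GDERIV f y :> gradf y"
    and sc: "strongly_convex \<mu> f gradf"
    and x: "\<And>t. a \<le> t \<Longrightarrow> (x has_vector_derivative v t) (at t within {a..})"
    and v: "\<And>t. a \<le> t \<Longrightarrow>
      (v has_vector_derivative - (p t *\<^sub>R v t) - gradf (x t)) (at t within {a..})"
    and e: "\<And>t. a \<le> t \<Longrightarrow> (e has_real_derivative \<beta> * p t * e t) (at t within {a..})"
      "\<And>t. a \<le> t \<Longrightarrow> e t > 0"
    and p: "\<And>t. a \<le> t \<Longrightarrow> (p has_real_derivative p' t) (at t within {a..})"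
      "\<And>t. a \<le> t \<Longrightarrow> (p' has_real_derivative p'' t) (at t within {a..})"
      "\<And>t. a \<le> t \<Longrightarrow> 0 \<le> p t"
    and beta: "0 \<le> \<beta>" "\<beta> \<le> 2 / 3"
    and cond: "\<And>t. a \<le> t \<Longrightarrow>
      \<beta> * (1 - \<beta>) * p t ^ 3 + (2 - 3 * \<beta>) * p t * p' t - p'' t \<le> \<mu> * p t"
    and pos: "\<And>t. a \<le> t \<Longrightarrow> p' t \<le> (1 - 2 * \<beta>) * (p t)\<^sup>2"
    and t: "a \<le> t"
  shows "e t * (f (x t) - f z) \<le> e a * twisted_energy \<beta> (p a) (p' a) (x a - z) (v a) (f (x a) - f z)"
proof -
  define L where "L t = e t * twisted_energy \<beta> (p t) (p' t) (x t - z) (v t) (f (x t) - f z)" for t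
  have deriv: "\<exists>D\<le>0. (L has_real_derivative D) (at t within {a..})" if t: "a \<le> t" for t
  proof -
    have fx: "((\<lambda>t. f (x t)) has_real_derivative gradf (x t) \<bullet> v t) (at t within {a..})"
      using has_derivative_compose[OF x[OF t, unfolded has_vector_derivative_def]
          grad[of "x t", unfolded gderiv_def]]
      unfolding has_field_derivative_def
      by (rule has_derivative_eq_rhs) (simp add: fun_eq_iff inner_commute)
    have inn: "((\<lambda>t. g t \<bullet> k t) has_real_derivative g t \<bullet> k' + g' \<bullet> k t) (at t within {a..})"
      if "(g has_vector_derivative g') (at t within {a..})" "(k has_vector_derivative k') (at t within {a..})"
      for g k :: "real \<Rightarrow> 'a" and g' k'
      using has_derivative_inner[OF that[unfolded has_vector_derivative_def]]
      unfolding has_field_derivative_def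
      by (rule has_derivative_eq_rhs) (simp add: fun_eq_iff algebra_simps)
    have y: "((\<lambda>t. x t - z) has_vector_derivative v t) (at t within {a..})"
      using has_vector_derivative_diff[OF x[OF t] has_vector_derivative_const] by simp
    define G where "G = gradf (x t)"
    define E where "E = twisted_energy \<beta> (p t) (p' t) (x t - z) (v t) (f (x t) - f z)"
    define R where "R = v t \<bullet> (- (p t *\<^sub>R v t) - G) + \<beta> * p' t * (v t \<bullet> (x t - z))
        + \<beta> * p t * ((- (p t *\<^sub>R v t) - G) \<bullet> (x t - z) + v t \<bullet> v t)
        + 1 / 2 * (2 * \<beta> * (1 - \<beta>) * p t * p' t - \<beta> * p'' t) * ((x t - z) \<bullet> (x t - z))
        + (\<beta> * (1 - \<beta>) * (p t)\<^sup>2 - \<beta> * p' t) * (v t \<bullet> (x t - z)) + G \<bullet> v t"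
    have "(L has_real_derivative e t * (\<beta> * p t * E + R)) (at t within {a..})"
      unfolding L_def twisted_energy_def
      apply (rule derivative_eq_intros e[OF t] p[OF t] fx inn[OF y y] inn[OF v[OF t] v[OF t]]
          inn[OF v[OF t] y] refl)+
      apply (simp add: E_def R_def G_def twisted_energy_def inner_diff_left inner_diff_right
          inner_commute algebra_simps power2_eq_square)
      done
    moreover have "\<beta> * p t * E + R \<le> 0"
      unfolding E_def R_def
    proof (rule twisted_energy_rate_nonpos[OF beta p(3)[OF t] _ cond[OF t]])
      have "f z - f (x t) - G \<bullet> (z - x t) \<ge> \<mu> / 2 * (norm (z - x t))\<^sup>2"
        using sc unfolding strongly_convex_def G_def by blast
      then show "f (x t) - f z + \<mu> / 2 * ((x t - z) \<bullet> (x t - z)) \<le> G \<bullet> (x t - z)"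
        by (simp add: norm_minus_commute[of z] power2_norm_eq_inner inner_diff_right)
    qed
    ultimately show ?thesis
      using e(2)[OF t] by (meson mult_nonneg_nonpos less_imp_le)
  qed
  \<comment> \<open>Derivatives at \<open>a\<close> are one-sided, so monotonicity is drawn from the open interval
    together with continuity on the closed one.\<close>
  have "L t \<le> L a"
  proof (rule DERIV_nonpos_imp_decreasing_open[OF t])
    fix s assume s: "a < s" "s < t"
    have "at s within {a..} = at s"
      using s by (intro at_within_interior) simp
    then show "\<exists>D. DERIV L s :> D \<and> D \<le> 0"
      using deriv[of s] s by auto
  next
    show "continuous_on {a..t} L"
    proof (rule continuous_on_subset)
      show "continuous_on {a..} L"
        unfolding continuous_on_eq_continuous_within using deriv DERIV_continuous by fastforce
    qed auto
  qed
  moreover have "e t * (f (x t) - f z) \<le> L t"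
    unfolding L_def using e(2)[OF t] twisted_energy_ge[OF beta(1) pos[OF t]] by simp
  ultimately show ?thesis
    by (simp add: L_def)
qed

section \<open>The Lyapunov function for power-law damping\<close>

lemma powr_damping_derivs:
  fixes t :: real
  assumes "t > 0"
  shows "((\<lambda>t. r * t powr - \<alpha>) has_real_derivative - \<alpha> * r * t powr (- \<alpha> - 1)) (at t within S)"
    and "((\<lambda>t. - \<alpha> * r * t powr (- \<alpha> - 1)) has_real_derivative \<alpha> * (\<alpha> + 1) * r * t powr (- \<alpha> - 2))
      (at t within S)"
    and "((\<lambda>t. coeff_D \<alpha> r \<beta> t) has_real_derivative \<beta> * (r * t powr - \<alpha>) * coeff_D \<alpha> r \<beta> t)
      (at t within S)"
proof -
  show "((\<lambda>t. r * t powr - \<alpha>) has_real_derivative - \<alpha> * r * t powr (- \<alpha> - 1)) (at t within S)"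
    using assms by (auto intro!: derivative_eq_intros)
  show "((\<lambda>t. - \<alpha> * r * t powr (- \<alpha> - 1)) has_real_derivative \<alpha> * (\<alpha> + 1) * r * t powr (- \<alpha> - 2))
      (at t within S)"
    using assms by (auto intro!: derivative_eq_intros simp: algebra_simps)
  have "((\<lambda>t. xi \<alpha> r t) has_real_derivative r * t powr - \<alpha>) (at t within S)"
  proof (cases "\<alpha> = 1")
    case True
    then show ?thesis
      unfolding xi_def using assms
      by (auto intro!: derivative_eq_intros simp: powr_minus field_simps)
  next
    case False
    then show ?thesis
      unfolding xi_def using assms by (auto intro!: derivative_eq_intros)
  qed
  then show "((\<lambda>t. coeff_D \<alpha> r \<beta> t) has_real_derivative \<beta> * (r * t powr - \<alpha>) * coeff_D \<alpha> r \<beta> t)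
      (at t within S)"
    unfolding coeff_D_def by (auto intro!: derivative_eq_intros)
qed

text \<open>
  Three identities carry this: with \<open>e = exp (\<beta> \<xi>)\<close>, \<open>A^2 + C = e\<close>, \<open>A B = \<beta> p e\<close> and
  \<open>B^2 = (\<beta>(1-\<beta>) p^2 - \<beta> p') e\<close> for \<open>p = r t^{-\<alpha>}\<close>.  Positivity of the denominator is
  what allows the square roots to be removed.
\<close>

lemma lyapunov_eq_twisted_energy:
  assumes t: "t > 0" and r: "r > 0" and beta: "0 \<le> \<beta>"
    and pos: "(1 - \<beta>) * r * t powr (1 - \<alpha>) + \<alpha> > 0"
  shows "lyapunov \<alpha> r \<beta> f z x v t = coeff_D \<alpha> r \<beta> t *
    twisted_energy \<beta> (r * t powr - \<alpha>) (- \<alpha> * r * t powr (- \<alpha> - 1)) (x t - z) (v t) (f (x t) - f z)"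
proof -
  define e where "e = exp (\<beta> * xi \<alpha> r t)"
  define k where "k = (1 - \<beta>) * r * t powr (1 - \<alpha>) + \<alpha>"
  define u where "u = t powr - \<alpha>"
  have e: "e > 0" and k: "k > 0" and u: "u > 0"
    using pos t by (auto simp: e_def k_def u_def)
  have pw: "t powr (1 - \<alpha>) = t * u" "t powr (- \<alpha> - 1) = u / t"
    using t by (auto simp: u_def powr_diff powr_minus field_simps)
  have A: "coeff_A \<alpha> r \<beta> t = sqrt (\<beta> * r * (t * u) / k * e)"
    and B: "coeff_B \<alpha> r \<beta> t = sqrt (\<beta> * r * k * (u / t) * e)"
    and C: "coeff_C \<alpha> r \<beta> t = (1 - \<beta> * r * (t * u) / k) * e"
    and D: "coeff_D \<alpha> r \<beta> t = e"
    by (simp_all add: coeff_A_def coeff_B_def coeff_C_def coeff_D_def e_def k_def pw)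
  have A2: "(coeff_A \<alpha> r \<beta> t)\<^sup>2 + coeff_C \<alpha> r \<beta> t = e"
    unfolding A C using beta r t u k e by (simp add: algebra_simps)
  have B2: "(coeff_B \<alpha> r \<beta> t)\<^sup>2 = \<beta> * r * k * (u / t) * e"
    unfolding B using beta r t u k e by simp
  have AB: "coeff_A \<alpha> r \<beta> t * coeff_B \<alpha> r \<beta> t = \<beta> * r * u * e"
  proof -
    have "coeff_A \<alpha> r \<beta> t * coeff_B \<alpha> r \<beta> t = sqrt ((\<beta> * r * u * e)\<^sup>2)"
      unfolding A B real_sqrt_mult[symmetric] using t k
      by (simp add: field_simps power2_eq_square)
    then show ?thesis
      using beta r u e by simp
  qed
  have k2: "k = (1 - \<beta>) * r * (t * u) + \<alpha>"
    by (simp add: k_def pw)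
  have "lyapunov \<alpha> r \<beta> f z x v t =
      1 / 2 * ((coeff_A \<alpha> r \<beta> t)\<^sup>2 + coeff_C \<alpha> r \<beta> t) * (v t \<bullet> v t)
      + coeff_A \<alpha> r \<beta> t * coeff_B \<alpha> r \<beta> t * (v t \<bullet> (x t - z))
      + 1 / 2 * (coeff_B \<alpha> r \<beta> t)\<^sup>2 * ((x t - z) \<bullet> (x t - z)) + e * (f (x t) - f z)"
    unfolding lyapunov_def D power2_norm_eq_inner inner_add_left inner_add_right
      inner_scaleR_left inner_scaleR_right inner_commute[of "x t - z" "v t"]
    by algebra
  also have "\<dots> = e * twisted_energy \<beta> (r * u) (- \<alpha> * r * (u / t)) (x t - z) (v t) (f (x t) - f z)"
  proof -
    have "(coeff_B \<alpha> r \<beta> t)\<^sup>2 = (\<beta> * (1 - \<beta>) * (r * u)\<^sup>2 - \<beta> * (- \<alpha> * r * (u / t))) * e"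
      unfolding B2 k2 using t by (simp add: field_simps power2_eq_square)
    then show ?thesis
      unfolding A2 AB twisted_energy_def by algebra
  qed
  finally show ?thesis
    by (simp add: D pw u_def)
qed

text \<open>
  The two sides differ by \<open>r t^{-\<alpha>-2} P(t)\<close>; this is where the function \<open>P\<close> comes from.
\<close>

lemma P_fun_nonneg_imp_rate_condition:
  assumes t: "t > 0" and r: "r > 0" and P: "P_fun \<mu> \<alpha> r \<beta> t \<ge> 0"
  shows "\<beta> * (1 - \<beta>) * (r * t powr - \<alpha>) ^ 3
      + (2 - 3 * \<beta>) * (r * t powr - \<alpha>) * (- \<alpha> * r * t powr (- \<alpha> - 1))
      - \<alpha> * (\<alpha> + 1) * r * t powr (- \<alpha> - 2) \<le> \<mu> * (r * t powr - \<alpha>)" (is "?l \<le> ?r")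
proof -
  define u where "u = t powr - \<alpha>"
  have u: "u > 0" using t by (simp add: u_def)
  have pw: "t powr (1 - \<alpha>) = t * u" "t powr (- \<alpha> - 1) = u / t" "t powr (- \<alpha> - 2) = u / t\<^sup>2"
    "t powr (2 * (1 - \<alpha>)) = t\<^sup>2 * u\<^sup>2"
    using t by (simp_all add: u_def powr_diff powr_minus powr_add[symmetric] field_simps
        power2_eq_square powr_numeral flip: power_mult_distrib)
  have "?r - ?l = r * u / t\<^sup>2 * P_fun \<mu> \<alpha> r \<beta> t"
    unfolding P_fun_def pw u_def[symmetric] using t
    by (simp add: field_simps power2_eq_square power3_eq_cube)
  also have "\<dots> \<ge> 0"
    using r u P by simp
  finally show ?thesis by simp
qed

text \<open>
  For \<open>\<alpha> > 0\<close> the term \<open>\<mu> t^2\<close> dominates at infinity, so a negative value of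
  \<open>P\<close> at \<open>t\<close> forces a root beyond \<open>t\<close>.  The roots beyond \<open>t\<close> form a closed bounded
  set, hence a largest root exists; it is then the value of \<open>T_val\<close> and lies to the right of
  \<open>t\<close>, a contradiction.
\<close>

lemma P_fun_nonneg_from_T_val:
  assumes mu: "\<mu> > 0" and alpha: "0 < \<alpha>" "\<alpha> < 1"
    and t: "t > 0" "T_val \<mu> \<alpha> r \<beta> \<le> t"
  shows "P_fun \<mu> \<alpha> r \<beta> t \<ge> 0"
proof (rule ccontr)
  assume "\<not> P_fun \<mu> \<alpha> r \<beta> t \<ge> 0"
  then have neg: "P_fun \<mu> \<alpha> r \<beta> t < 0" by simp
  let ?P = "P_fun \<mu> \<alpha> r \<beta>"
  have cont: "continuous_on {a..} ?P" if "a > 0" for a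
    unfolding P_fun_def using that by (intro continuous_intros) auto
  have "filterlim ?P at_top at_top"
    unfolding P_fun_def using mu alpha by real_asymp
  then have "\<forall>\<^sub>F s in at_top. ?P s > 0"
    by (simp add: filterlim_at_top_dense)
  then obtain M where M: "\<And>s. s \<ge> M \<Longrightarrow> ?P s > 0"
    by (auto simp: eventually_at_top_linorder)
  define R where "R = {s. s \<ge> t \<and> ?P s = 0}"
  have bdd: "s \<le> max M t" if "s > 0" "?P s = 0" for s
    using M[of s] that by fastforce
  have "\<exists>s\<ge>t. s \<le> max M t \<and> ?P s = 0"
    by (rule IVT') (use neg M[of "max M t"] cont[OF t(1)] in \<open>auto intro: continuous_on_subset\<close>)
  then have "R \<noteq> {}"
    by (auto simp: R_def)
  have bR: "bdd_above R"
    using bdd t by (intro bdd_aboveI[of _ "max M t"]) (auto simp: R_def)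
  have "closed R"
    using continuous_closed_preimage_constant[OF cont[OF t(1)], of 0]
    by (simp add: R_def)
  then have Sup: "Sup R \<in> R"
    using closed_contains_Sup[OF \<open>R \<noteq> {}\<close> bR] by simp
  then have S: "t \<le> Sup R" "?P (Sup R) = 0"
    by (auto simp: R_def)
  have "(GREATEST s. s > 0 \<and> ?P s = 0) = Sup R"
  proof (rule Greatest_equality)
    show "0 < Sup R \<and> ?P (Sup R) = 0"
      using S t by auto
    fix s assume s: "0 < s \<and> ?P s = 0"
    show "s \<le> Sup R"
    proof (cases "s \<ge> t")
      case True
      then show ?thesis using s bR by (intro cSup_upper) (auto simp: R_def)
    next
      case False
      then show ?thesis using S by simp
    qed
  qed
  moreover have "\<exists>s>0. ?P s = 0"
    using S t by (meson less_le_trans)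
  ultimately have "Sup R \<le> t"
    using t unfolding T_val_def by simp
  with S neg show False
    by simp
qed

lemma ode_solution_on_ray:
  assumes sol: "ode_solution \<alpha> r g I x v" and I: "{a..} \<subseteq> I" and t: "a \<le> t"
  shows "(x has_vector_derivative v t) (at t within {a..})"
    and "(v has_vector_derivative - (damping \<alpha> r t *\<^sub>R v t) - g (x t)) (at t within {a..})"
proof -
  have tI: "t \<in> I" using I t by auto
  then obtain b where b: "(v has_vector_derivative b) (at t within I)"
    "b + damping \<alpha> r t *\<^sub>R v t + g (x t) = 0" and x: "(x has_vector_derivative v t) (at t within I)"
    using sol unfolding ode_solution_def by blast
  have "b = - (damping \<alpha> r t *\<^sub>R v t) - g (x t)"
    using b(2) by (simp add: algebra_simps eq_neg_iff_add_eq_0)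
  then show "(v has_vector_derivative - (damping \<alpha> r t *\<^sub>R v t) - g (x t)) (at t within {a..})"
    using has_vector_derivative_within_subset[OF b(1) I] by simp
  show "(x has_vector_derivative v t) (at t within {a..})"
    using has_vector_derivative_within_subset[OF x I] .
qed

text \<open>
  Hypothesis \<open>pos\<close> says that \<open>C \<ge> 0\<close>.  For \<open>\<alpha> < 1\<close> and all \<open>t > 0\<close> this follows from
  \<open>\<beta> \<le> 1/2\<close>; for \<open>\<alpha> = 1\<close> it reads \<open>\<beta> \<le> (1 + r) / (2 r)\<close>.
\<close>

theorem lyapunov_bound:
  fixes f :: "'a::euclidean_space \<Rightarrow> real"
  assumes grad: "\<And>y. GDERIV f y :> gradf y"
    and sc: "strongly_convex \<mu> f gradf"
    and sol: "ode_solution \<alpha> r gradf I x v" and I: "{a..} \<subseteq> I"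
    and a: "a > 0" and r: "r > 0" and alpha: "\<alpha> > 0"
    and beta: "0 \<le> \<beta>" "\<beta> \<le> 2 / 3"
    and pos: "\<And>t. a \<le> t \<Longrightarrow> 0 \<le> (1 - 2 * \<beta>) * r * t powr (1 - \<alpha>) + \<alpha>"
    and P: "\<And>t. a \<le> t \<Longrightarrow> 0 \<le> P_fun \<mu> \<alpha> r \<beta> t"
    and t: "a \<le> t"
  shows "coeff_D \<alpha> r \<beta> t * (f (x t) - f z) \<le> lyapunov \<alpha> r \<beta> f z x v a"
proof -
  have "(1 - \<beta>) * r * a powr (1 - \<alpha>) + \<alpha> > 0"
    using beta r a alpha by (intro add_nonneg_pos) auto
  then have eq: "lyapunov \<alpha> r \<beta> f z x v a = coeff_D \<alpha> r \<beta> a *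
    twisted_energy \<beta> (r * a powr - \<alpha>) (- \<alpha> * r * a powr (- \<alpha> - 1)) (x a - z) (v a) (f (x a) - f z)"
    using lyapunov_eq_twisted_energy[OF a r beta(1)] by blast
  have damp: "damping \<alpha> r s = r * s powr - \<alpha>" for s
    using alpha by (simp add: damping_def powr_minus divide_inverse)
  show ?thesis
    unfolding eq
  proof (rule damped_gradient_flow_decay[where \<mu> = \<mu> and gradf = gradf
        and p = "\<lambda>t. r * t powr - \<alpha>" and p' = "\<lambda>t. - \<alpha> * r * t powr (- \<alpha> - 1)"
        and p'' = "\<lambda>t. \<alpha> * (\<alpha> + 1) * r * t powr (- \<alpha> - 2)"])
    fix s assume s: "a \<le> s"
    then have s0: "s > 0" using a by simp
    show "(x has_vector_derivative v s) (at s within {a..})"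
      "(v has_vector_derivative - ((r * s powr - \<alpha>) *\<^sub>R v s) - gradf (x s)) (at s within {a..})"
      using ode_solution_on_ray[OF sol I s] by (simp_all add: damp)
    show "- \<alpha> * r * s powr (- \<alpha> - 1) \<le> (1 - 2 * \<beta>) * (r * s powr - \<alpha>)\<^sup>2"
    proof -
      have pw: "s powr (1 - \<alpha>) = s * s powr - \<alpha>" "s powr (- \<alpha> - 1) = s powr - \<alpha> / s"
        using s0 by (auto simp: powr_diff powr_minus field_simps)
      have "(1 - 2 * \<beta>) * (r * s powr - \<alpha>)\<^sup>2 - (- \<alpha> * r * s powr (- \<alpha> - 1))
          = r * s powr - \<alpha> / s * ((1 - 2 * \<beta>) * r * s powr (1 - \<alpha>) + \<alpha>)"
        unfolding pw using s0 by (simp add: field_simps power2_eq_square)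
      also have "\<dots> \<ge> 0"
        using pos[OF s] r s0 by simp
      finally show ?thesis by simp
    qed
  qed (use powr_damping_derivs r P P_fun_nonneg_imp_rate_condition a grad sc beta t
      in \<open>auto simp: coeff_D_def\<close>)
qed

section \<open>Convergence rates\<close>

text \<open>
  The choices of \<open>\<beta>\<close> are the largest ones that the decay and positivity conditions admit:
  \<open>1/2\<close> for \<open>\<alpha> < 1\<close>, where the positivity condition requires it for large \<open>t\<close>, and
  the minimum of \<open>2/3\<close> and \<open>(1 + r) / (2 r)\<close> for \<open>\<alpha> = 1\<close>, which switches at \<open>r = 3\<close>.
  With \<open>\<alpha> = 0\<close> and \<open>r = 2 sqrt \<mu>\<close> the rate condition holds with equality.  With
  \<open>\<alpha> = 1\<close> and \<open>r > 3\<close>, \<open>P(t) = \<mu> t^2 - (r-3)(r+1)/4\<close>, whose root is the stated threshold;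
  with \<open>r \<le> 3\<close>, \<open>P(t) = \<mu> t^2 - 2 r^2 / 9 + 2\<close> is nonnegative everywhere, so the bound starts
  at \<open>t\<^sub>0\<close>, where the velocity vanishes and the Lyapunov function reduces to the constant of
  the claim.
\<close>

theorem theorem1p3:
  fixes f :: "real ^ 'd \<Rightarrow> real" and gradf :: "real ^ 'd \<Rightarrow> real ^ 'd"
    and xstar x\<^sub>0 :: "real ^ 'd"
    and x v :: "real \<Rightarrow> real ^ 'd"
    and \<mu> r \<alpha> t\<^sub>0 :: real and I :: "real set"
  assumes C2: "twice_continuously_differentiable f"
    and conv: "convex_on UNIV f"
    and grad: "\<And>y. GDERIV f y :> gradf y"
    and lip: "\<exists>K. K-lipschitz_on UNIV gradf"
    and minimizer: "unique_minimizer f xstar"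
    and mu: "\<mu> > 0" and sc: "strongly_convex \<mu> f gradf"
    and r: "r > 0" and alpha: "0 \<le> \<alpha>" "\<alpha> \<le> 1"
    and t0: "\<alpha> > 0 \<Longrightarrow> t\<^sub>0 > 0"
    and I: "is_interval I" "{t\<^sub>0..} \<subseteq> I" "\<alpha> > 0 \<Longrightarrow> I \<subseteq> {0<..}"
    and sol: "ode_solution \<alpha> r gradf I x v"
    and init: "x t\<^sub>0 = x\<^sub>0" "v t\<^sub>0 = 0"
  shows
    "(\<alpha> = 0 \<and> t\<^sub>0 = 0 \<and> r = 2 * sqrt \<mu> \<longrightarrow>
        (\<forall>t\<ge>t\<^sub>0. f (x t) - f xstar
           \<le> (\<mu> / 2 * (norm (x\<^sub>0 - xstar))\<^sup>2 + f x\<^sub>0 - f xstar) * exp (- sqrt \<mu> * t)))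
   \<and> (0 < \<alpha> \<and> \<alpha> < 1 \<longrightarrow>
        (let T = T_val \<mu> \<alpha> r (1 / 2); L = lyapunov \<alpha> r (1 / 2) f xstar x v;
             E = (\<lambda>t. exp (- (r / (2 * (1 - \<alpha>)) * t powr (1 - \<alpha>)))) in
           (T \<in> I \<longrightarrow> (\<forall>t\<ge>T. f (x t) - f xstar \<le> L T * E t)) \<and>
           (T < t\<^sub>0 \<longrightarrow> (\<forall>t\<ge>t\<^sub>0. f (x t) - f xstar \<le> L t\<^sub>0 * E t))))
   \<and> (\<alpha> = 1 \<longrightarrow>
        (r > 3 \<longrightarrow>
          (let T = sqrt ((r - 3) * (r + 1) / (4 * \<mu>));
               L = lyapunov \<alpha> r ((1 + r) / (2 * r)) f xstar x v;
               E = (\<lambda>t. t powr (- ((1 + r) / 2))) in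
             (T \<in> I \<longrightarrow> (\<forall>t\<ge>T. f (x t) - f xstar \<le> L T * E t)) \<and>
             (T < t\<^sub>0 \<longrightarrow> (\<forall>t\<ge>t\<^sub>0. f (x t) - f xstar \<le> L t\<^sub>0 * E t)))) \<and>
        (r \<le> 3 \<longrightarrow>
          (\<forall>t\<ge>t\<^sub>0. f (x t) - f xstar
             \<le> (r / 3 * (r / 3 + 1) * t\<^sub>0 powr (2 / 3 * r - 2) * (norm (x\<^sub>0 - xstar))\<^sup>2
                 + t\<^sub>0 powr (2 / 3 * r) * (f x\<^sub>0 - f xstar)) * t powr (- (2 / 3 * r)))))"
  proof (intro conjI impI)
  \<comment> \<open>The threshold may lie before \<open>t\<^sub>0\<close> but in \<open>I\<close>, so the bounds are started at an
    arbitrary time in \<open>I\<close>.\<close>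
  have ray: "{s..} \<subseteq> I" if "s \<in> I" for s
  proof
    fix u assume u: "u \<in> {s..}"
    have "max u t\<^sub>0 \<in> I" using I(2) by auto
    with that u show "u \<in> I"
      using mem_is_interval_1_I[OF I(1), of s "max u t\<^sub>0" u] by auto
  qed
  have t0I: "t\<^sub>0 \<in> I" using I(2) by auto
  {
    assume a: "\<alpha> = 0 \<and> t\<^sub>0 = 0 \<and> r = 2 * sqrt \<mu>"
    then have r2: "r\<^sup>2 = 4 * \<mu>" using mu by simp
    show "\<forall>t\<ge>t\<^sub>0. f (x t) - f xstar
           \<le> (\<mu> / 2 * (norm (x\<^sub>0 - xstar))\<^sup>2 + f x\<^sub>0 - f xstar) * exp (- sqrt \<mu> * t)"
    proof (intro allI impI)
      fix t assume t: "t\<^sub>0 \<le> t"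
      have "exp (sqrt \<mu> * t) * (f (x t) - f xstar) \<le> exp (sqrt \<mu> * t\<^sub>0) *
          twisted_energy (1 / 2) r 0 (x t\<^sub>0 - xstar) (v t\<^sub>0) (f (x t\<^sub>0) - f xstar)"
      proof (rule damped_gradient_flow_decay[OF grad sc, where p = "\<lambda>_. r" and p' = "\<lambda>_. 0"
            and p'' = "\<lambda>_. 0" and e = "\<lambda>t. exp (sqrt \<mu> * t)" and a = t\<^sub>0])
        fix s assume s: "t\<^sub>0 \<le> s"
        show "(x has_vector_derivative v s) (at s within {t\<^sub>0..})"
          "(v has_vector_derivative - (r *\<^sub>R v s) - gradf (x s)) (at s within {t\<^sub>0..})"
          using ode_solution_on_ray[OF sol I(2) s] a by (simp_all add: damping_def)
        show "((\<lambda>t. exp (sqrt \<mu> * t)) has_real_derivative 1 / 2 * r * exp (sqrt \<mu> * s))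
            (at s within {t\<^sub>0..})"
          using a by (auto intro!: derivative_eq_intros)
        show "1 / 2 * (1 - 1 / 2) * r ^ 3 + (2 - 3 * (1 / 2)) * r * 0 - 0 \<le> \<mu> * r"
          using r2 by (simp add: power3_eq_cube power2_eq_square)
      qed (use r t in auto)
      also have "\<dots> = \<mu> / 2 * (norm (x\<^sub>0 - xstar))\<^sup>2 + f x\<^sub>0 - f xstar"
        using a r2 init by (simp add: twisted_energy_def power2_norm_eq_inner)
      finally show "f (x t) - f xstar
           \<le> (\<mu> / 2 * (norm (x\<^sub>0 - xstar))\<^sup>2 + f x\<^sub>0 - f xstar) * exp (- sqrt \<mu> * t)"
        by (simp add: exp_minus field_simps)
    qed
  }
  {
    assume a: "0 < \<alpha> \<and> \<alpha> < 1"
    have bound: "f (x t) - f xstar \<le> lyapunov \<alpha> r (1 / 2) f xstar x v s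
        * exp (- (r / (2 * (1 - \<alpha>)) * t powr (1 - \<alpha>)))"
      if s: "s \<in> I" "T_val \<mu> \<alpha> r (1 / 2) \<le> s" "s \<le> t" for s t
    proof -
      have s0: "s > 0" using s I(3) a by auto
      have "coeff_D \<alpha> r (1 / 2) t * (f (x t) - f xstar) \<le> lyapunov \<alpha> r (1 / 2) f xstar x v s"
        by (rule lyapunov_bound[OF grad sc sol ray[OF s(1)] s0 r])
          (use a s s0 mu in \<open>auto intro!: P_fun_nonneg_from_T_val\<close>)
      moreover have "coeff_D \<alpha> r (1 / 2) t = exp (r / (2 * (1 - \<alpha>)) * t powr (1 - \<alpha>))"
        using a by (simp add: coeff_D_def xi_def)
      ultimately show ?thesis
        by (simp add: exp_minus field_simps)
    qed
    show "let T = T_val \<mu> \<alpha> r (1 / 2); L = lyapunov \<alpha> r (1 / 2) f xstar x v;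
             E = (\<lambda>t. exp (- (r / (2 * (1 - \<alpha>)) * t powr (1 - \<alpha>)))) in
           (T \<in> I \<longrightarrow> (\<forall>t\<ge>T. f (x t) - f xstar \<le> L T * E t)) \<and>
           (T < t\<^sub>0 \<longrightarrow> (\<forall>t\<ge>t\<^sub>0. f (x t) - f xstar \<le> L t\<^sub>0 * E t))"
      unfolding Let_def using bound t0I by simp
  }
  {
    assume a: "\<alpha> = 1"
    have bound: "f (x t) - f xstar \<le> lyapunov \<alpha> r \<beta> f xstar x v s * t powr (- (\<beta> * r))"
      if s: "s \<in> I" "s \<le> t" and beta: "0 \<le> \<beta>" "\<beta> \<le> 2 / 3" "2 * \<beta> * r \<le> r + 1"
        and P: "\<And>u. s \<le> u \<Longrightarrow> 0 \<le> \<mu> * u\<^sup>2 - (1 - \<beta>) * \<beta> * r\<^sup>2 + (2 - 3 * \<beta>) * r + 2" for s t \<beta>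
    proof -
      have s0: "s > 0" using s I(3) a by auto
      have "coeff_D \<alpha> r \<beta> t * (f (x t) - f xstar) \<le> lyapunov \<alpha> r \<beta> f xstar x v s"
      proof (rule lyapunov_bound[OF grad sc sol ray[OF s(1)] s0 r])
        fix u assume u: "s \<le> u"
        show "0 \<le> (1 - 2 * \<beta>) * r * u powr (1 - \<alpha>) + \<alpha>"
          using a u s0 beta by (simp add: algebra_simps)
        show "0 \<le> P_fun \<mu> \<alpha> r \<beta> u"
          using P[OF u] a u s0 by (simp add: P_fun_def)
      qed (use a s beta in auto)
      moreover have "coeff_D \<alpha> r \<beta> t = t powr (\<beta> * r)"
        using a s s0 by (simp add: coeff_D_def xi_def powr_def)
      moreover have "t powr (\<beta> * r) > 0" using s s0 by simp
      ultimately show ?thesis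
        by (simp add: powr_minus field_simps)
    qed
    {
      assume r3: "r > 3"
      let ?T = "sqrt ((r - 3) * (r + 1) / (4 * \<mu>))"
      define b where "b = (1 + r) / (2 * r)"
      have br: "b * r = (1 + r) / 2" using r by (simp add: b_def)
      have b: "(1 - b) * b * r\<^sup>2 = (r - 1) * (r + 1) / 4" "(2 - 3 * b) * r = (r - 3) / 2"
        using r by (auto simp: b_def field_simps power2_eq_square)
      have "?T \<ge> 0" using r3 mu by simp
      have bound': "f (x t) - f xstar \<le> lyapunov \<alpha> r b f xstar x v s * t powr (- ((1 + r) / 2))"
        if s: "s \<in> I" "?T \<le> s" "s \<le> t" for s t
        unfolding br[symmetric]
      proof (rule bound[OF s(1,3)])
        fix u assume u: "s \<le> u"
        have "(r - 3) * (r + 1) / (4 * \<mu>) \<le> u\<^sup>2"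
          using u s \<open>?T \<ge> 0\<close> by (intro sqrt_le_D) linarith
        then have "(r - 3) * (r + 1) / 4 \<le> \<mu> * u\<^sup>2"
          using mu by (simp add: field_simps)
        then show "0 \<le> \<mu> * u\<^sup>2 - (1 - b) * b * r\<^sup>2 + (2 - 3 * b) * r + 2"
          unfolding b by (simp add: field_simps)
      qed (use r r3 in \<open>auto simp: b_def field_simps\<close>)
      show "let T = ?T; L = lyapunov \<alpha> r ((1 + r) / (2 * r)) f xstar x v; E = (\<lambda>t. t powr (- ((1 + r) / 2))) in
             (T \<in> I \<longrightarrow> (\<forall>t\<ge>T. f (x t) - f xstar \<le> L T * E t)) \<and>
             (T < t\<^sub>0 \<longrightarrow> (\<forall>t\<ge>t\<^sub>0. f (x t) - f xstar \<le> L t\<^sub>0 * E t))"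
        unfolding Let_def b_def[symmetric] using bound' t0I by simp
    }
    {
      assume r3: "r \<le> 3"
      have t0p: "t\<^sub>0 > 0" using t0 a by simp
      have "lyapunov \<alpha> r (2 / 3) f xstar x v t\<^sub>0 = coeff_D \<alpha> r (2 / 3) t\<^sub>0 *
          twisted_energy (2 / 3) (r * t\<^sub>0 powr - \<alpha>) (- \<alpha> * r * t\<^sub>0 powr (- \<alpha> - 1))
            (x t\<^sub>0 - xstar) (v t\<^sub>0) (f (x t\<^sub>0) - f xstar)"
        by (rule lyapunov_eq_twisted_energy) (use t0p r a in auto)
      also have "coeff_D \<alpha> r (2 / 3) t\<^sub>0 = t\<^sub>0 powr (2 / 3 * r)"
        using a t0p by (simp add: coeff_D_def xi_def powr_def)
      also have "twisted_energy (2 / 3) (r * t\<^sub>0 powr - \<alpha>) (- \<alpha> * r * t\<^sub>0 powr (- \<alpha> - 1))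
            (x t\<^sub>0 - xstar) (v t\<^sub>0) (f (x t\<^sub>0) - f xstar)
          = r / 3 * (r / 3 + 1) / t\<^sub>0\<^sup>2 * (norm (x\<^sub>0 - xstar))\<^sup>2 + (f x\<^sub>0 - f xstar)"
      proof -
        have "t\<^sub>0 powr - 1 = 1 / t\<^sub>0" "t\<^sub>0 powr - 2 = 1 / t\<^sub>0\<^sup>2"
          using t0p by (simp_all add: powr_minus field_simps)
        then show ?thesis
          using a init t0p unfolding twisted_energy_def power2_norm_eq_inner
          by (simp add: field_simps power2_eq_square)
      qed
      also have "t\<^sub>0 powr (2 / 3 * r) * \<dots> =
          r / 3 * (r / 3 + 1) * t\<^sub>0 powr (2 / 3 * r - 2) * (norm (x\<^sub>0 - xstar))\<^sup>2
            + t\<^sub>0 powr (2 / 3 * r) * (f x\<^sub>0 - f xstar)"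
      proof -
        have "t\<^sub>0 powr (2 / 3 * r - 2) = t\<^sub>0 powr (2 / 3 * r) / t\<^sub>0\<^sup>2"
          using t0p by (simp add: powr_diff)
        then show ?thesis by (simp add: distrib_left)
      qed
      finally have L: "lyapunov \<alpha> r (2 / 3) f xstar x v t\<^sub>0 =
          r / 3 * (r / 3 + 1) * t\<^sub>0 powr (2 / 3 * r - 2) * (norm (x\<^sub>0 - xstar))\<^sup>2
            + t\<^sub>0 powr (2 / 3 * r) * (f x\<^sub>0 - f xstar)" .
      have "r\<^sup>2 \<le> 9"
        using r r3 power_mono[of r 3 2] by simp
      then have "0 \<le> \<mu> * u\<^sup>2 - (1 - 2 / 3) * (2 / 3) * r\<^sup>2 + (2 - 3 * (2 / 3)) * r + 2" for u
      proof -
        have "\<mu> * u\<^sup>2 \<ge> 0" using mu by simp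
        with \<open>r\<^sup>2 \<le> 9\<close> show ?thesis by argo
      qed
      then show "\<forall>t\<ge>t\<^sub>0. f (x t) - f xstar
             \<le> (r / 3 * (r / 3 + 1) * t\<^sub>0 powr (2 / 3 * r - 2) * (norm (x\<^sub>0 - xstar))\<^sup>2
                 + t\<^sub>0 powr (2 / 3 * r) * (f x\<^sub>0 - f xstar)) * t powr (- (2 / 3 * r))"
        unfolding L[symmetric] using mu r3 t0I by (intro allI impI bound) auto
    }
  }
qed

end
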